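(* Let $p,q\ge 1$ be integers with $p$ odd. Let $X=\begin{bmatrix} A & B\\ C& D\end{bmatrix}$ be a complex $(p+q)\times(p+q)$ matrix, partitioned so that $A$ is $p\times p$, $B$ is $p\times q$, $C$ is $q\times p$, and $D$ is $q\times q$. Then $$X\big(J_p(0)\oplus \Gamma_q\big)+\big(J_p(0)\oplus \Gamma_q\big)X^T=0$$ if and only if all of the following hold: (i) $AJ_p(0)+J_p(0)A^T=0$; (ii) $D\Gamma_q+\Gamma_qD^T=0$; (iii) there exist constants $\alpha_1,\alpha_2,\ldots,\alpha_q\in\mathbb{C}$ such that $$C=P_q^{-T}\left(\sum_{\ell=1}^{q}\alpha_\ell\big(J_q(0)^T\big)^{\ell-1}\right)W^T;$$ (iv) $B=-J_p(0)^T C^T\Gamma_q^{-T}$.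
   Context: $M^T$ denotes the transpose (no conjugation) and $M^{-T}=(M^{-1})^T$. $J_n(0)$ is the $n\times n$ Jordan block with eigenvalue $0$: its $(i,i+1)$ entries equal $1$ for $1\le i\le n-1$ and all other entries are $0$; $\big(J_q(0)^T\big)^0=I_q$. $\Gamma_q$ is the $q\times q$ matrix whose entries are $[\Gamma_q]_{q+1-m,\,m}=(-1)^{m+1}$ for $1\le m\le q$, $[\Gamma_q]_{q+2-m,\,m}=(-1)^{m}$ for $2\le m\le q$, and $0$ elsewhere; that is, $$\Gamma_q=\begin{bmatrix}0&0&0&\cdots&0&(-1)^{q+1}\\0&0&0&\cdots&(-1)^q&(-1)^q\\ \vdots&\vdots&\vdots&&\vdots&\vdots\\0&0&1&\cdots&0&0\\0&-1&-1&\cdots&0&0\\1&1&0&\cdots&0&0\end{bmatrix}.$$ $M\oplus N$ denotes the block-diagonal direct sum. Binomial coefficients satisfy $\binom{n}{k}=0$ whenever $k<0$ (and as usual $\binom{n}{k}=0$ for $k>n\geq 0$). $P_q$ is the $q\times q$ upper triangular (invertible) matrix with entries $[P_q]_{i,j}=2^{q-j}(-1)^{j-i}\binom{j-1}{j-i}$; its inverse is the upper triangular matrix with entries $[P_q^{-1}]_{i,j}=2^{i-q}\binom{j-1}{j-i}$. $W$ is the $p\times q$ matrix with entries $[W]_{i,j}=0$ if $i$ is even and $[W]_{i,j}=(-1)^{\frac{i-1}{2}(q-1)}\binom{(i-1)/2}{j-1}$ if $i$ is odd. *)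

theory Defs
  imports
    "Jordan_Normal_Form.Jordan_Normal_Form"
    "Jordan_Normal_Form.Gauss_Jordan_Elimination"
    Complex_Main
begin

text \<open>Matrices of the library are indexed from 0; \<open>mat1\<close> takes an entry formula whose row and column
  indices start at 1.\<close>

definition mat1 :: "nat \<Rightarrow> nat \<Rightarrow> (nat \<Rightarrow> nat \<Rightarrow> 'a) \<Rightarrow> 'a mat" where
  "mat1 m n f = mat m n (\<lambda>(i, j). f (Suc i) (Suc j))"

lemma mat1_carrier [simp]: "mat1 m n f \<in> carrier_mat m n"
  by (simp add: mat1_def)

lemma mat1_dim [simp]: "dim_row (mat1 m n f) = m" "dim_col (mat1 m n f) = n"
  by (simp_all add: mat1_def)

lemma mat1_index [simp]: "i < m \<Longrightarrow> j < n \<Longrightarrow> mat1 m n f $$ (i, j) = f (Suc i) (Suc j)"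
  by (simp add: mat1_def)

text \<open>The library's inverse is option-valued; \<open>mat_inv\<close> is unspecified on singular matrices. It is only
  applied to \<open>Gamma_mat\<close> and \<open>P_mat\<close>, shown invertible below.\<close>

definition mat_inv :: "'a :: field mat \<Rightarrow> 'a mat" where
  "mat_inv A = the (mat_inverse A)"

lemma mat_inv_of_det:
  fixes A :: "'a :: field mat"
  assumes A: "A \<in> carrier_mat n n" and d: "det A \<noteq> 0"
  shows "mat_inv A \<in> carrier_mat n n" "A * mat_inv A = 1\<^sub>m n" "mat_inv A * A = 1\<^sub>m n"
proof -
  have "A \<in> Units (ring_mat TYPE('a) n ())"
    using det_non_zero_imp_unit[OF A d] .
  then obtain B where "mat_inverse A = Some B"
    using mat_inverse(1)[OF A, where b = "()"] by (cases "mat_inverse A") auto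
  then show "mat_inv A \<in> carrier_mat n n" "A * mat_inv A = 1\<^sub>m n" "mat_inv A * A = 1\<^sub>m n"
    using mat_inverse(2)[OF A] by (auto simp: mat_inv_def)
qed

abbreviation mat_inv_transpose :: "'a :: field mat \<Rightarrow> 'a mat" where
  "mat_inv_transpose A \<equiv> transpose_mat (mat_inv A)"

definition Gamma_mat :: "nat \<Rightarrow> complex mat" where
  "Gamma_mat q = mat1 q q (\<lambda>i j.
     if i + j = q + 1 then (- 1) ^ (j + 1)
     else if i + j = q + 2 then (- 1) ^ j
     else 0)"

definition P_mat :: "nat \<Rightarrow> complex mat" where
  "P_mat q = mat1 q q (\<lambda>i j.
     if i \<le> j then 2 ^ (q - j) * (- 1) ^ (j - i) * of_nat ((j - 1) choose (j - i)) else 0)"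

definition W_mat :: "nat \<Rightarrow> nat \<Rightarrow> complex mat" where
  "W_mat p q = mat1 p q (\<lambda>i j.
     if even i then 0
     else (- 1) ^ ((i - 1) div 2 * (q - 1)) * of_nat (((i - 1) div 2) choose (j - 1)))"

lemma Gamma_mat_carrier [simp]: "Gamma_mat q \<in> carrier_mat q q"
  by (simp add: Gamma_mat_def)

lemma P_mat_carrier [simp]: "P_mat q \<in> carrier_mat q q"
  by (simp add: P_mat_def)

lemma W_mat_carrier [simp]: "W_mat p q \<in> carrier_mat p q"
  by (simp add: W_mat_def)

lemma det_P_mat: "det (P_mat q) \<noteq> 0"
proof -
  have "upper_triangular (P_mat q)"
    by (auto simp: P_mat_def)
  then have "det (P_mat q) = prod_list (diag_mat (P_mat q))"
    using det_upper_triangular P_mat_carrier by blast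
  also have "\<dots> \<noteq> 0"
    by (auto simp: prod_list_zero_iff diag_mat_def P_mat_def)
  finally show ?thesis .
qed

lemma det_Gamma_mat: "det (Gamma_mat q) \<noteq> 0"
proof
  assume "det (Gamma_mat q) = 0"
  then obtain v where v: "v \<in> carrier_vec q" "v \<noteq> 0\<^sub>v q" "Gamma_mat q *\<^sub>v v = 0\<^sub>v q"
    using det_0_iff_vec_prod_zero[OF Gamma_mat_carrier] by blast
  have row: "(\<Sum>j<q. Gamma_mat q $$ (i, j) * v $ j) = 0" if "i < q" for i
  proof -
    have "(\<Sum>j<q. Gamma_mat q $$ (i, j) * v $ j) = (Gamma_mat q *\<^sub>v v) $ i"
      using that v(1)
      by (auto simp: scalar_prod_def Gamma_mat_def lessThan_atLeast0 intro!: sum.cong)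
    then show ?thesis using v(3) that by simp
  qed
  have "v $ (q - 1 - i) = 0" if "i < q" for i
    using that
  proof (induction i rule: less_induct)
    case (less i)
    have "0 = (\<Sum>j<q. Gamma_mat q $$ (i, j) * v $ j)"
      using row less.prems by simp
    also have "\<dots> = (\<Sum>j\<in>{q - 1 - i}. Gamma_mat q $$ (i, j) * v $ j)"
    proof (rule sum.mono_neutral_right)
      show "\<forall>j\<in>{..<q} - {q - 1 - i}. Gamma_mat q $$ (i, j) * v $ j = 0"
      proof
        fix j assume j: "j \<in> {..<q} - {q - 1 - i}"
        show "Gamma_mat q $$ (i, j) * v $ j = 0"
        proof (cases "i + j = q")
          case True
          then have "j = q - 1 - (i - 1)" "i - 1 < i" using j by auto
          then have "v $ j = 0" using less.IH[of "i - 1"] less.prems by simp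
          then show ?thesis by simp
        next
          case False
          then show ?thesis using j less.prems by (auto simp: Gamma_mat_def)
        qed
      qed
    qed (use less.prems in auto)
    also have "\<dots> = (- 1) ^ (q - 1 - i) * v $ (q - 1 - i)"
      using less.prems by (simp add: Gamma_mat_def)
    finally show ?case by simp
  qed
  then have "v $ j = 0" if "j < q" for j
    using that by (metis Suc_diff_1 diff_diff_cancel diff_less_Suc gr_implies_not0 less_Suc_eq_le not_gr_zero)
  then have "v = 0\<^sub>v q" using v(1) by auto
  with v(2) show False by simp
qed

end

theory Submission
  imports Defs
begin

text \<open>
  Write \<open>J = J\<^sub>p(0)\<close>, \<open>N = J\<^sub>q(0)\<close>, \<open>\<Gamma> = \<Gamma>\<^sub>q\<close>, \<open>P = P\<^sub>q\<close>. The equation splits into its four blocks. The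
  diagonal blocks are (i) and (ii). The lower left block \<open>C J + \<Gamma> B\<^sup>T = 0\<close> can be solved for \<open>B\<close>,
  because \<open>\<Gamma>\<close> is invertible; this is (iv). What has to be explained is why the remaining block
  \<open>B \<Gamma> + J C\<^sup>T = 0\<close> becomes (iii). After \<open>B\<close> is eliminated, it is a condition on \<open>Y = C\<^sup>T\<close> alone,
  namely \<open>J\<^sup>T Y K = J Y\<close> with the cosquare \<open>K = \<Gamma>\<^sup>-\<^sup>T \<Gamma>\<close>.

  The matrix \<open>P\<close> is there to bring \<open>K\<close> to a Jordan-like form: \<open>K P = P L\<close> with
  \<open>L = (-1)\<^sup>q\<^sup>-\<^sup>1 (I + N)\<close> (\<open>Gamma_mat_mult_P_mat\<close>). Column \<open>j\<close> of \<open>P\<close>, counted from 0, lists the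
  coefficients of \<open>2\<^sup>q\<^sup>-\<^sup>1\<^sup>-\<^sup>j (x - 1)\<^sup>j\<close>, so the identity amounts to Pascal's rule. Hence
  \<open>Z = Y P\<close> has to satisfy \<open>J\<^sup>T Z L = J Z\<close>.

  Multiplication by \<open>J\<close> and \<open>J\<^sup>T\<close> moves the rows up and down, so that equation is a two-step recurrence
  for the rows \<open>z\<^sub>0, z\<^sub>1, \<dots>\<close> of \<open>Z\<close>: if \<open>p > 1\<close>, it says \<open>z\<^sub>1 = 0\<close> and \<open>z\<^sub>k\<^sub>+\<^sub>1 = z\<^sub>k\<^sub>-\<^sub>1 L\<close>, and the last
  row gives \<open>z\<^sub>p\<^sub>-\<^sub>2 L = 0\<close>. A solution is therefore determined by \<open>z\<^sub>0\<close>
  (\<open>jordan_shift_equation_unique\<close>). The binomial theorem for \<open>(I + N)\<^sup>k\<close> shows that \<open>W\<close> is the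
  solution with \<open>z\<^sub>0\<close> the first unit vector (\<open>W_mat_shift_equation\<close>); oddness of \<open>p\<close> makes row
  \<open>p - 2\<close> one of the zero rows. If \<open>T\<close> is an upper triangular Toeplitz matrix, it is a polynomial
  in \<open>N\<close> and commutes with \<open>L\<close>, so \<open>W T\<close> is again a solution, and its row 0 is row 0 of \<open>T\<close>, which is
  arbitrary. So the solutions are exactly \<open>Z = W T\<close> (\<open>jordan_shift_equation_iff\<close>), and transposing
  \<open>C\<^sup>T P = W T\<close> gives (iii).
\<close>

section \<open>Multiplication by a nilpotent Jordan block\<close>

lemma index_mult_mat_sum:
  assumes "A \<in> carrier_mat n k" and "B \<in> carrier_mat k m" and "i < n" and "j < m"
  shows "(A * B) $$ (i, j) = (\<Sum>l\<in>{0..<k}. A $$ (i, l) * B $$ (l, j))"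
  using assms by (auto simp: scalar_prod_def)

text \<open>The default rule rewrites entries of products to scalar products of rows and columns, which would
  hide the shifts below; from here on they are computed by dedicated lemmas.\<close>

declare index_mult_mat(1) [simp del]

lemma jordan_block_mult_index:
  fixes M :: "'a :: semiring_1 mat"
  assumes "M \<in> carrier_mat n m" and "i < n" and "j < m"
  shows "(jordan_block n 0 * M) $$ (i, j) = (if Suc i < n then M $$ (Suc i, j) else 0)"
proof -
  have "(jordan_block n 0 * M) $$ (i, j)
      = (\<Sum>k\<in>{0..<n}. if k = Suc i then M $$ (Suc i, j) else 0)"
    by (insert assms, (subst index_mult_mat_sum[of _ n n _ m]; (rule sum.cong)?; auto))
  also have "\<dots> = (if Suc i < n then M $$ (Suc i, j) else 0)"
    by (subst sum.delta) auto
  finally show ?thesis .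
qed

lemma jordan_block_transpose_mult_index:
  fixes M :: "'a :: semiring_1 mat"
  assumes "M \<in> carrier_mat n m" and "i < n" and "j < m"
  shows "(transpose_mat (jordan_block n 0) * M) $$ (i, j) = (if i = 0 then 0 else M $$ (i - 1, j))"
proof -
  have "(transpose_mat (jordan_block n 0) * M) $$ (i, j)
      = (\<Sum>k\<in>{0..<n}. if k = i - 1 then (if i = 0 then 0 else M $$ (i - 1, j)) else 0)"
    by (insert assms, (subst index_mult_mat_sum[of _ n n _ m]; (rule sum.cong)?; auto))
  also have "\<dots> = (if i = 0 then 0 else M $$ (i - 1, j))"
    using assms by (subst sum.delta) auto
  finally show ?thesis .
qed

lemma mult_jordan_block_index:
  fixes M :: "'a :: semiring_1 mat"
  assumes "M \<in> carrier_mat m n" and "i < m" and "j < n"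
  shows "(M * jordan_block n 0) $$ (i, j) = (if j = 0 then 0 else M $$ (i, j - 1))"
proof -
  have "(M * jordan_block n 0) $$ (i, j)
      = (\<Sum>k\<in>{0..<n}. if k = j - 1 then (if j = 0 then 0 else M $$ (i, j - 1)) else 0)"
    by (insert assms, (subst index_mult_mat_sum[of _ m n _ n]; (rule sum.cong)?; auto))
  also have "\<dots> = (if j = 0 then 0 else M $$ (i, j - 1))"
    using assms by (subst sum.delta) auto
  finally show ?thesis .
qed

lemma mult_smult_one_plus_jordan_block_index:
  fixes M :: "'a :: comm_ring_1 mat"
  assumes M: "M \<in> carrier_mat m n" and "i < m" and "j < n"
  shows "(M * (c \<cdot>\<^sub>m (1\<^sub>m n + jordan_block n 0))) $$ (i, j)
       = c * (M $$ (i, j) + (if j = 0 then 0 else M $$ (i, j - 1)))"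
proof -
  have "M * (c \<cdot>\<^sub>m (1\<^sub>m n + jordan_block n 0)) = c \<cdot>\<^sub>m (M * (1\<^sub>m n + jordan_block n 0))"
    using M by (intro mult_smult_distrib[of _ m n _ n]) auto
  also have "M * (1\<^sub>m n + jordan_block n 0) = M + M * jordan_block n 0"
    using M by (simp add: mult_add_distrib_mat[of _ m n _ n])
  finally show ?thesis
    using assms by (simp add: mult_jordan_block_index)
qed

section \<open>Upper triangular Toeplitz matrices\<close>

lemma jordan_block_transpose_pow_index:
  assumes "i < n" and "j < n"
  shows "(transpose_mat (jordan_block n (0 :: 'a :: comm_ring_1)) ^\<^sub>m k) $$ (i, j)
       = (if i = j + k then 1 else 0)"
  using assms
proof (induction k arbitrary: i j)
  case 0
  then show ?case by simp
next
  case (Suc k)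
  let ?N = "transpose_mat (jordan_block n (0 :: 'a))"
  have "(?N ^\<^sub>m Suc k) $$ (i, j) = (\<Sum>l\<in>{0..<n}. (?N ^\<^sub>m k) $$ (i, l) * ?N $$ (l, j))"
    using Suc.prems index_mult_mat_sum[of "?N ^\<^sub>m k" n n ?N n i j] by simp
  also have "\<dots> = (\<Sum>l\<in>{0..<n}. if l = Suc j then (if i = Suc j + k then 1 else 0) else 0)"
    using Suc by (intro sum.cong refl) auto
  also have "\<dots> = (if i = j + Suc k then 1 else 0)"
    using Suc.prems by (subst sum.delta) auto
  finally show ?case .
qed

lemma finsum_ring_mat_carrier:
  fixes f :: "'b \<Rightarrow> 'a :: comm_ring_1 mat"
  assumes "\<And>l. l \<in> I \<Longrightarrow> f l \<in> carrier_mat n n"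
  shows "finsum (ring_mat TYPE('a) n b) f I \<in> carrier_mat n n"
proof -
  interpret R: ring "ring_mat TYPE('a) n b" by (rule ring_mat)
  show ?thesis
    using R.finsum_closed[of f I] assms by (auto simp: ring_mat_simps)
qed

lemma finsum_ring_mat_index:
  fixes f :: "'b \<Rightarrow> 'a :: comm_ring_1 mat"
  assumes "finite I" and "\<And>l. l \<in> I \<Longrightarrow> f l \<in> carrier_mat n n" and "i < n" and "j < n"
  shows "finsum (ring_mat TYPE('a) n b) f I $$ (i, j) = (\<Sum>l\<in>I. f l $$ (i, j))"
  using assms(1,2)
proof (induction I rule: finite_induct)
  interpret R: ring "ring_mat TYPE('a) n b" by (rule ring_mat)
  case empty
  then show ?case using assms(3,4) by (simp add: ring_mat_simps)
next
  interpret R: ring "ring_mat TYPE('a) n b" by (rule ring_mat)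
  case (insert x F)
  have "finsum (ring_mat TYPE('a) n b) f (insert x F)
      = f x + finsum (ring_mat TYPE('a) n b) f F"
    using insert by (subst R.finsum_insert) (auto simp: ring_mat_simps)
  then show ?case
    using insert assms(3,4) finsum_ring_mat_carrier[of F f n b] by simp
qed

text \<open>The argument of \<open>\<alpha>\<close> starts at 1, to agree with the coefficients \<open>\<alpha>\<^sub>1, \<dots>, \<alpha>\<^sub>q\<close> of the sum below.\<close>

definition toeplitz :: "nat \<Rightarrow> (nat \<Rightarrow> 'a :: zero) \<Rightarrow> 'a mat" where
  "toeplitz n \<alpha> = mat n n (\<lambda>(i, j). if i \<le> j then \<alpha> (Suc (j - i)) else 0)"

lemma toeplitz_carrier [simp]: "toeplitz n \<alpha> \<in> carrier_mat n n"
  by (simp add: toeplitz_def)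

lemma finsum_jordan_block_pow_eq_toeplitz:
  fixes \<alpha> :: "nat \<Rightarrow> 'a :: comm_ring_1"
  shows "(\<Oplus>\<^bsub>ring_mat TYPE('a) n b\<^esub> l\<in>{1..n}.
            \<alpha> l \<cdot>\<^sub>m (transpose_mat (jordan_block n 0) ^\<^sub>m (l - 1))) = transpose_mat (toeplitz n \<alpha>)"
    (is "?S = _")
proof (rule eq_matI)
  have S: "?S \<in> carrier_mat n n"
    by (intro finsum_ring_mat_carrier) auto
  then show "dim_row ?S = dim_row (transpose_mat (toeplitz n \<alpha>))"
    and "dim_col ?S = dim_col (transpose_mat (toeplitz n \<alpha>))"
    by (auto simp: toeplitz_def)
  fix i j assume "i < dim_row (transpose_mat (toeplitz n \<alpha>))"
    and "j < dim_col (transpose_mat (toeplitz n \<alpha>))"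
  then have ij: "i < n" "j < n" by (auto simp: toeplitz_def)
  have "?S $$ (i, j) = (\<Sum>l\<in>{1..n}. (\<alpha> l \<cdot>\<^sub>m (transpose_mat (jordan_block n 0) ^\<^sub>m (l - 1))) $$ (i, j))"
    using ij by (intro finsum_ring_mat_index) auto
  also have "\<dots> = (\<Sum>l\<in>{1..n}. if l = Suc (i - j) then (if j \<le> i then \<alpha> (Suc (i - j)) else 0) else 0)"
    using ij by (intro sum.cong) (auto simp: jordan_block_transpose_pow_index pow_mat_dim)
  also have "\<dots> = (if j \<le> i then \<alpha> (Suc (i - j)) else 0)"
    using ij by (subst sum.delta) auto
  also have "\<dots> = transpose_mat (toeplitz n \<alpha>) $$ (i, j)"
    using ij by (simp add: toeplitz_def)
  finally show "?S $$ (i, j) = transpose_mat (toeplitz n \<alpha>) $$ (i, j)" .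
qed

lemma toeplitz_commute_jordan_block:
  fixes \<alpha> :: "nat \<Rightarrow> 'a :: semiring_1"
  shows "toeplitz n \<alpha> * jordan_block n 0 = jordan_block n 0 * toeplitz n \<alpha>" (is "?l = ?r")
proof (rule eq_matI)
  fix i j assume "i < dim_row ?r" and "j < dim_col ?r"
  then have ij: "i < n" "j < n" by (auto simp: toeplitz_def)
  show "?l $$ (i, j) = ?r $$ (i, j)"
    using ij
    by (auto simp: mult_jordan_block_index[OF toeplitz_carrier]
        jordan_block_mult_index[OF toeplitz_carrier])
       (auto simp: toeplitz_def intro!: arg_cong[of _ _ \<alpha>])
qed (auto simp: toeplitz_def)

lemma toeplitz_commute_smult_one_plus_jordan_block:
  fixes \<alpha> :: "nat \<Rightarrow> 'a :: comm_ring_1"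
  shows "toeplitz n \<alpha> * (c \<cdot>\<^sub>m (1\<^sub>m n + jordan_block n 0))
       = (c \<cdot>\<^sub>m (1\<^sub>m n + jordan_block n 0)) * toeplitz n \<alpha>"
proof -
  have "toeplitz n \<alpha> * (c \<cdot>\<^sub>m (1\<^sub>m n + jordan_block n 0))
      = c \<cdot>\<^sub>m (toeplitz n \<alpha> * (1\<^sub>m n + jordan_block n 0))"
    by (intro mult_smult_distrib[of _ n n _ n]) auto
  also have "toeplitz n \<alpha> * (1\<^sub>m n + jordan_block n 0) = (1\<^sub>m n + jordan_block n 0) * toeplitz n \<alpha>"
    by (simp add: mult_add_distrib_mat[OF toeplitz_carrier one_carrier_mat jordan_block_carrier]
        add_mult_distrib_mat[OF one_carrier_mat jordan_block_carrier toeplitz_carrier]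
        toeplitz_commute_jordan_block left_mult_one_mat[OF toeplitz_carrier]
        right_mult_one_mat[OF toeplitz_carrier])
  also have "c \<cdot>\<^sub>m \<dots> = (c \<cdot>\<^sub>m (1\<^sub>m n + jordan_block n 0)) * toeplitz n \<alpha>"
    by (intro mult_smult_assoc_mat[of _ n n _ n, symmetric]) auto
  finally show ?thesis .
qed

section \<open>The cosquare of \<open>\<Gamma>\<close>\<close>

text \<open>A column \<open>v\<close> with \<open>v\<^sub>q = 0\<close> is sent by \<open>\<Gamma>\<close> to the reversed, sign-alternating sums
  \<open>v\<^sub>m + v\<^sub>m\<^sub>+\<^sub>1\<close>, and by \<open>\<Gamma>\<^sup>T\<close> to the corresponding differences \<open>v\<^sub>m - v\<^sub>m\<^sub>+\<^sub>1\<close>. The signs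
  \<open>(-1)\<^sup>q\<^sup>-\<^sup>1\<^sup>-\<^sup>i\<close> and \<open>(-1)\<^sup>i\<close> in row \<open>i\<close> differ by \<open>(-1)\<^sup>q\<^sup>-\<^sup>1\<close>, which is the scalar factor of \<open>L\<close>.\<close>

lemma Gamma_mat_mult_index:
  assumes M: "M \<in> carrier_mat q n" and i: "i < q" and j: "j < n"
  shows "(Gamma_mat q * M) $$ (i, j)
       = (- 1) ^ (q - Suc i) * (M $$ (q - Suc i, j) + (if i = 0 then 0 else M $$ (q - i, j)))"
proof -
  have "(Gamma_mat q * M) $$ (i, j) = (\<Sum>k\<in>{0..<q}.
      (if k = q - Suc i then (- 1) ^ (q - Suc i) * M $$ (q - Suc i, j) else 0)
      + (if k = q - i then (if i = 0 then 0 else (- 1) ^ (q - Suc i) * M $$ (q - i, j)) else 0))"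
    by (insert assms, (subst index_mult_mat_sum[of _ q q _ n]; (rule sum.cong)?;
        auto simp: Gamma_mat_def Suc_diff_Suc[symmetric]))
  also have "\<dots> = (- 1) ^ (q - Suc i) * (M $$ (q - Suc i, j) + (if i = 0 then 0 else M $$ (q - i, j)))"
    using i by (simp add: sum.distrib sum.delta algebra_simps)
  finally show ?thesis .
qed

lemma Gamma_mat_transpose_mult_index:
  assumes M: "M \<in> carrier_mat q n" and i: "i < q" and j: "j < n"
  shows "(transpose_mat (Gamma_mat q) * M) $$ (i, j)
       = (- 1) ^ i * (M $$ (q - Suc i, j) - (if i = 0 then 0 else M $$ (q - i, j)))"
proof -
  have "(transpose_mat (Gamma_mat q) * M) $$ (i, j) = (\<Sum>k\<in>{0..<q}.
      (if k = q - Suc i then (- 1) ^ i * M $$ (q - Suc i, j) else 0)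
      + (if k = q - i then (if i = 0 then 0 else - ((- 1) ^ i * M $$ (q - i, j))) else 0))"
    by (insert assms, (subst index_mult_mat_sum[of _ q q _ n]; (rule sum.cong)?;
        auto simp: Gamma_mat_def))
  also have "\<dots> = (- 1) ^ i * (M $$ (q - Suc i, j) - (if i = 0 then 0 else M $$ (q - i, j)))"
    using i by (simp add: sum.distrib sum.delta algebra_simps)
  finally show ?thesis .
qed

lemma P_mat_index:
  assumes "i < q" and "j < q"
  shows "P_mat q $$ (i, j) = 2 ^ (q - Suc j) * (- 1) ^ (i + j) * of_nat (j choose i)"
proof (cases "i \<le> j")
  case True
  then have "(- 1 :: complex) ^ (i + j) = (- 1) ^ (j - i)"
    by (metis le_add_diff_inverse minus_one_power_iff even_add even_diff_nat add.commute)
  with True assms show ?thesis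
    by (simp add: P_mat_def binomial_symmetric[of i j])
next
  case False
  with assms show ?thesis by (simp add: P_mat_def)
qed

text \<open>The coefficients of \<open>(x - 1)\<^sup>j\<^sup>+\<^sup>1 = x (x - 1)\<^sup>j - (x - 1)\<^sup>j\<close>; the factor 2 comes from the scaling of
  the columns of \<open>P\<close>.\<close>

lemma P_mat_pascal:
  assumes "Suc i < q" and "Suc j < q"
  shows "2 * P_mat q $$ (Suc i, Suc j) = P_mat q $$ (i, j) - P_mat q $$ (Suc i, j)"
proof -
  have "(2 :: complex) ^ (q - Suc j) = 2 * 2 ^ (q - Suc (Suc j))"
    using assms by (metis Suc_diff_Suc power_Suc)
  with assms show ?thesis
    by (simp add: P_mat_index algebra_simps)
qed

text \<open>That \<open>\<Gamma>\<^sup>-\<^sup>T \<Gamma> P = P L\<close>, written without inverses. If \<open>v\<close> and \<open>v'\<close> are columns \<open>j\<close> and \<open>j - 1\<close> of \<open>P\<close>, the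
  claim is \<open>v\<^sub>m + v\<^sub>m\<^sub>+\<^sub>1 = u\<^sub>m - u\<^sub>m\<^sub>+\<^sub>1\<close> for \<open>u = v + v'\<close>, that is
  \<open>2 v\<^sub>m\<^sub>+\<^sub>1 = v'\<^sub>m - v'\<^sub>m\<^sub>+\<^sub>1\<close>. At the edges (\<open>j = 0\<close>, or \<open>m = q - 1\<close> with index \<open>q\<close> read as 0) both sides vanish.\<close>

lemma Gamma_mat_mult_P_mat:
  "Gamma_mat q * P_mat q
     = transpose_mat (Gamma_mat q) * (P_mat q * ((- 1) ^ (q - 1) \<cdot>\<^sub>m (1\<^sub>m q + jordan_block q 0)))"
    (is "?l = _ * (_ * ?L)")
proof (rule eq_matI)
  let ?r = "transpose_mat (Gamma_mat q) * (P_mat q * ?L)"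
  show "dim_row ?l = dim_row ?r" and "dim_col ?l = dim_col ?r"
    by (auto simp: Gamma_mat_def P_mat_def)
  fix i j assume "i < dim_row ?r" and "j < dim_col ?r"
  then have i: "i < q" and j: "j < q" by (auto simp: Gamma_mat_def)
  let ?e = "(- 1) ^ (q - 1) :: complex"
  define u where "u m = P_mat q $$ (m, j) + (if j = 0 then 0 else P_mat q $$ (m, j - 1))" for m
  have PL: "(P_mat q * ?L) $$ (m, j) = ?e * u m" if "m < q" for m
    unfolding u_def using that j by (intro mult_smult_one_plus_jordan_block_index) auto
  have sgn: "(- 1 :: complex) ^ (q - Suc i) = (- 1) ^ i * ?e"
  proof -
    have "(- 1 :: complex) ^ (q - Suc i) = (- 1) ^ i * (- 1) ^ i * (- 1) ^ (q - Suc i)"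
      by (simp flip: power_mult_distrib)
    also have "\<dots> = (- 1) ^ i * (- 1) ^ (i + (q - Suc i))"
      by (simp only: power_add mult.assoc)
    also have "i + (q - Suc i) = q - 1" using i by simp
    finally show ?thesis .
  qed
  have entries: "P_mat q $$ (q - Suc i, j) + (if i = 0 then 0 else P_mat q $$ (q - i, j))
      = u (q - Suc i) - (if i = 0 then 0 else u (q - i))"
  proof (cases j)
    case 0
    then show ?thesis using i by (auto simp: u_def P_mat_index)
  next
    case (Suc j')
    show ?thesis
    proof (cases i)
      case 0
      then show ?thesis using Suc j by (simp add: u_def P_mat_index)
    next
      case (Suc i')
      then have "2 * P_mat q $$ (q - i, j) = P_mat q $$ (q - Suc i, j') - P_mat q $$ (q - i, j')"
        using P_mat_pascal[of "q - Suc i" q j'] i j \<open>j = Suc j'\<close> by (simp add: Suc_diff_Suc)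
      then show ?thesis using Suc \<open>j = Suc j'\<close> by (simp add: u_def algebra_simps)
    qed
  qed
  have "?l $$ (i, j) = (- 1) ^ (q - Suc i)
      * (P_mat q $$ (q - Suc i, j) + (if i = 0 then 0 else P_mat q $$ (q - i, j)))"
    using i j by (intro Gamma_mat_mult_index) auto
  also have "\<dots> = (- 1) ^ i * (?e * u (q - Suc i) - (if i = 0 then 0 else ?e * u (q - i)))"
    unfolding entries sgn by (simp add: algebra_simps)
  also have "\<dots> = (- 1) ^ i * ((P_mat q * ?L) $$ (q - Suc i, j)
      - (if i = 0 then 0 else (P_mat q * ?L) $$ (q - i, j)))"
    using i PL[of "q - Suc i"] PL[of "q - i"] by auto
  also have "\<dots> = ?r $$ (i, j)"
    using i j by (intro Gamma_mat_transpose_mult_index[symmetric]) (auto intro!: mult_carrier_mat)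
  finally show "?l $$ (i, j) = ?r $$ (i, j)" .
qed

section \<open>The equation \<open>J\<^sup>T Z L = J Z\<close>\<close>

text \<open>Row \<open>k\<close> of the equation expresses row \<open>k + 1\<close> of a solution through row \<open>k - 1\<close>, and row 0 forces
  row 1 to vanish; so two solutions that agree in row 0 agree by induction.\<close>

lemma jordan_shift_equation_unique:
  fixes Z Z' L :: "'a :: comm_ring_1 mat"
  assumes Z: "Z \<in> carrier_mat p q" and Z': "Z' \<in> carrier_mat p q" and L: "L \<in> carrier_mat q q"
    and eqZ: "transpose_mat (jordan_block p 0) * (Z * L) = jordan_block p 0 * Z"
    and eqZ': "transpose_mat (jordan_block p 0) * (Z' * L) = jordan_block p 0 * Z'"
    and row0: "\<And>j. p > 0 \<Longrightarrow> j < q \<Longrightarrow> Z $$ (0, j) = Z' $$ (0, j)"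
  shows "Z = Z'"
proof -
  have step: "M $$ (Suc i, j) = (if i = 0 then 0 else \<Sum>l\<in>{0..<q}. M $$ (i - 1, l) * L $$ (l, j))"
    if M: "M \<in> carrier_mat p q"
      and eq: "transpose_mat (jordan_block p 0) * (M * L) = jordan_block p 0 * M"
      and ij: "Suc i < p" "j < q" for M i j
  proof -
    have "M $$ (Suc i, j) = (jordan_block p 0 * M) $$ (i, j)"
      using jordan_block_mult_index[OF M, of i j] ij by simp
    also have "\<dots> = (transpose_mat (jordan_block p 0) * (M * L)) $$ (i, j)"
      by (simp only: eq)
    also have "\<dots> = (if i = 0 then 0 else (M * L) $$ (i - 1, j))"
      using M L ij by (intro jordan_block_transpose_mult_index[of _ p q]) auto
    finally show ?thesis
      using index_mult_mat_sum[OF M L, of "i - 1" j] ij by simp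
  qed
  have "\<forall>j<q. Z $$ (i, j) = Z' $$ (i, j)" if "i < p" for i
    using that
  proof (induction i rule: less_induct)
    case (less i)
    show ?case
    proof (cases i)
      case 0
      with less.prems row0 show ?thesis by simp
    next
      case (Suc k)
      show ?thesis
      proof (intro allI impI)
        fix j assume "j < q"
        have "(\<Sum>l\<in>{0..<q}. Z $$ (k - 1, l) * L $$ (l, j))
            = (\<Sum>l\<in>{0..<q}. Z' $$ (k - 1, l) * L $$ (l, j))"
          using less.IH[of "k - 1"] less.prems Suc by (intro sum.cong) auto
        then show "Z $$ (i, j) = Z' $$ (i, j)"
          using step[OF Z eqZ, of k j] step[OF Z' eqZ', of k j] less.prems Suc \<open>j < q\<close> by simp
      qed
    qed
  qed
  then show ?thesis using Z Z' by (intro eq_matI) auto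
qed

lemma W_mat_index:
  assumes "i < p" and "j < q"
  shows "W_mat p q $$ (i, j)
       = (if odd i then 0 else ((- 1) ^ (q - 1)) ^ (i div 2) * of_nat (i div 2 choose j))"
  using assms by (simp add: W_mat_def mult.commute flip: power_mult)

text \<open>The recurrence for the even rows (counted from 0) is Pascal's rule. If \<open>p > 1\<close>, the equation of the last row
  requires \<open>w\<^sub>p\<^sub>-\<^sub>2 L = 0\<close>, which holds because \<open>p - 2\<close> is odd and odd rows of \<open>W\<close> are zero.\<close>

lemma W_mat_shift_equation:
  assumes "odd p"
  shows "transpose_mat (jordan_block p 0)
           * (W_mat p q * ((- 1) ^ (q - 1) \<cdot>\<^sub>m (1\<^sub>m q + jordan_block q 0)))
       = jordan_block p 0 * W_mat p q" (is "_ * (_ * ?L) = ?r")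
proof (rule eq_matI)
  let ?l = "transpose_mat (jordan_block p 0) * (W_mat p q * ?L)"
  show "dim_row ?l = dim_row ?r" and "dim_col ?l = dim_col ?r"
    by (auto simp: W_mat_def)
  fix i j assume "i < dim_row ?r" and "j < dim_col ?r"
  then have i: "i < p" and j: "j < q" by (auto simp: W_mat_def)
  have WL: "(W_mat p q * ?L) $$ (k, j) = (if Suc (Suc k) < p then W_mat p q $$ (Suc (Suc k), j) else 0)"
    if k: "Suc k < p" for k
  proof -
    have "(W_mat p q * ?L) $$ (k, j) = (- 1) ^ (q - 1)
        * (W_mat p q $$ (k, j) + (if j = 0 then 0 else W_mat p q $$ (k, j - 1)))"
      using k j by (intro mult_smult_one_plus_jordan_block_index[OF W_mat_carrier]) auto
    also have "\<dots> = (if odd k then 0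
        else ((- 1) ^ (q - 1)) ^ Suc (k div 2) * of_nat (Suc (k div 2) choose j))"
      using k j by (cases j) (auto simp: W_mat_index algebra_simps)
    also have "\<dots> = (if Suc (Suc k) < p then W_mat p q $$ (Suc (Suc k), j) else 0)"
    proof (cases "Suc (Suc k) < p")
      case True
      with j show ?thesis by (simp add: W_mat_index)
    next
      case False
      then have "p = Suc (Suc k)" using k by simp
      with \<open>odd p\<close> show ?thesis by simp
    qed
    finally show ?thesis .
  qed
  have "?l $$ (i, j) = (if i = 0 then 0 else (W_mat p q * ?L) $$ (i - 1, j))"
    using i j by (intro jordan_block_transpose_mult_index[of _ p q]) (auto intro!: mult_carrier_mat)
  also have "\<dots> = (if Suc i < p then W_mat p q $$ (Suc i, j) else 0)"
    using i j WL[of "i - 1"] by (cases i) (auto simp: W_mat_index)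
  also have "\<dots> = ?r $$ (i, j)"
    using i j by (intro jordan_block_mult_index[symmetric]) auto
  finally show "?l $$ (i, j) = ?r $$ (i, j)" .
qed

text \<open>The parameters are the entries of row 0 of \<open>Z\<close>: \<open>W T\<close> solves the equation since \<open>T\<close> commutes with \<open>L\<close>, and
  row 0 of \<open>W T\<close> is row 0 of \<open>T\<close>, hence any prescribed row.\<close>

lemma jordan_shift_equation_iff:
  assumes "odd p" and Z: "Z \<in> carrier_mat p q"
  shows "transpose_mat (jordan_block p 0) * (Z * ((- 1) ^ (q - 1) \<cdot>\<^sub>m (1\<^sub>m q + jordan_block q 0)))
           = jordan_block p 0 * Z
     \<longleftrightarrow> (\<exists>\<alpha>. Z = W_mat p q * toeplitz q \<alpha>)" (is "_ * (_ * ?L) = _ \<longleftrightarrow> _")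
proof -
  let ?J = "jordan_block p (0 :: complex)"
  have L: "?L \<in> carrier_mat q q" by simp
  have WT: "transpose_mat ?J * (W_mat p q * toeplitz q \<alpha> * ?L) = ?J * (W_mat p q * toeplitz q \<alpha>)" for \<alpha>
  proof -
    have "W_mat p q * toeplitz q \<alpha> * ?L = W_mat p q * (?L * toeplitz q \<alpha>)"
      by (subst assoc_mult_mat[of _ p q _ q _ q])
         (simp_all add: toeplitz_commute_smult_one_plus_jordan_block)
    also have "\<dots> = W_mat p q * ?L * toeplitz q \<alpha>"
      by (intro assoc_mult_mat[of _ p q _ q _ q, symmetric]) auto
    also have "transpose_mat ?J * \<dots> = transpose_mat ?J * (W_mat p q * ?L) * toeplitz q \<alpha>"
      by (intro assoc_mult_mat[of _ p p _ q _ q, symmetric]) (auto intro!: mult_carrier_mat)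
    also have "\<dots> = ?J * W_mat p q * toeplitz q \<alpha>"
      by (simp only: W_mat_shift_equation[OF \<open>odd p\<close>])
    also have "\<dots> = ?J * (W_mat p q * toeplitz q \<alpha>)"
      by (intro assoc_mult_mat[of _ p p _ q _ q]) auto
    finally show ?thesis .
  qed
  \<comment> \<open>Row 0 of \<open>W\<close> is the first unit vector.\<close>
  have row0: "(W_mat p q * toeplitz q \<alpha>) $$ (0, j) = \<alpha> (Suc j)" if j: "j < q" for \<alpha> j
  proof -
    have p: "p > 0" using \<open>odd p\<close> by (simp add: odd_pos)
    have "(W_mat p q * toeplitz q \<alpha>) $$ (0, j)
        = (\<Sum>l\<in>{0..<q}. W_mat p q $$ (0, l) * toeplitz q \<alpha> $$ (l, j))"
      using p j by (intro index_mult_mat_sum) auto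
    also have "\<dots> = (\<Sum>l\<in>{0..<q}. if l = 0 then \<alpha> (Suc j) else 0)"
      using p j by (intro sum.cong) (auto simp: W_mat_index toeplitz_def)
    also have "\<dots> = \<alpha> (Suc j)" using j by (subst sum.delta) auto
    finally show ?thesis .
  qed
  show ?thesis
  proof
    assume eq: "transpose_mat ?J * (Z * ?L) = ?J * Z"
    have "Z = W_mat p q * toeplitz q (\<lambda>l. Z $$ (0, l - 1))"
      by (rule jordan_shift_equation_unique[OF Z _ L eq WT])
         (auto simp: row0 intro!: mult_carrier_mat[OF W_mat_carrier toeplitz_carrier])
    then show "\<exists>\<alpha>. Z = W_mat p q * toeplitz q \<alpha>" by blast
  next
    assume "\<exists>\<alpha>. Z = W_mat p q * toeplitz q \<alpha>"
    with WT show "transpose_mat ?J * (Z * ?L) = ?J * Z" by auto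
  qed
qed

section \<open>Reduction of the block equation\<close>

lemma four_block_mat_eq_zero_iff:
  assumes "A \<in> carrier_mat m n" and "B \<in> carrier_mat m n'"
    and "C \<in> carrier_mat m' n" and "D \<in> carrier_mat m' n'"
  shows "four_block_mat A B C D = 0\<^sub>m (m + m') (n + n')
     \<longleftrightarrow> A = 0\<^sub>m m n \<and> B = 0\<^sub>m m n' \<and> C = 0\<^sub>m m' n \<and> D = 0\<^sub>m m' n'" (is "?F = _ \<longleftrightarrow> _")
proof
  assume F: "?F = 0\<^sub>m (m + m') (n + n')"
  have F0: "?F $$ (i, j) = 0" if "i < m + m'" "j < n + n'" for i j
    using that by (simp add: F)
  have "A $$ (i, j) = 0" if "i < m" "j < n" for i j
    using F0[of i j] that assms by auto
  moreover have "B $$ (i, j) = 0" if "i < m" "j < n'" for i j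
    using F0[of i "n + j"] that assms by auto
  moreover have "C $$ (i, j) = 0" if "i < m'" "j < n" for i j
    using F0[of "m + i" j] that assms by auto
  moreover have "D $$ (i, j) = 0" if "i < m'" "j < n'" for i j
    using F0[of "m + i" "n + j"] that assms by auto
  ultimately show "A = 0\<^sub>m m n \<and> B = 0\<^sub>m m n' \<and> C = 0\<^sub>m m' n \<and> D = 0\<^sub>m m' n'"
    using assms by (auto intro!: eq_matI)
next
  assume "A = 0\<^sub>m m n \<and> B = 0\<^sub>m m n' \<and> C = 0\<^sub>m m' n \<and> D = 0\<^sub>m m' n'"
  then show "?F = 0\<^sub>m (m + m') (n + n')" by simp
qed

lemma block_congruence_equation_iff:
  fixes J G :: "'a :: comm_ring_1 mat"
  assumes A: "A \<in> carrier_mat p p" and B: "B \<in> carrier_mat p q"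
    and C: "C \<in> carrier_mat q p" and D: "D \<in> carrier_mat q q"
    and J: "J \<in> carrier_mat p p" and G: "G \<in> carrier_mat q q"
  shows "four_block_mat A B C D * diag_block_mat [J, G]
       + diag_block_mat [J, G] * transpose_mat (four_block_mat A B C D) = 0\<^sub>m (p + q) (p + q)
     \<longleftrightarrow> A * J + J * transpose_mat A = 0\<^sub>m p p \<and> B * G + J * transpose_mat C = 0\<^sub>m p q
       \<and> C * J + G * transpose_mat B = 0\<^sub>m q p \<and> D * G + G * transpose_mat D = 0\<^sub>m q q"
proof -
  have JG: "diag_block_mat [J, G] = four_block_mat J (0\<^sub>m p q) (0\<^sub>m q p) G"
    unfolding diag_block_mat.simps(2)[of J] diag_block_mat_singleton
    using J G by (simp add: Let_def del: diag_block_mat.simps)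
  have "four_block_mat A B C D * four_block_mat J (0\<^sub>m p q) (0\<^sub>m q p) G
      = four_block_mat (A * J + B * 0\<^sub>m q p) (A * 0\<^sub>m p q + B * G)
          (C * J + D * 0\<^sub>m q p) (C * 0\<^sub>m p q + D * G)"
    using assms by (intro mult_four_block_mat) auto
  then have 1: "four_block_mat A B C D * four_block_mat J (0\<^sub>m p q) (0\<^sub>m q p) G
      = four_block_mat (A * J) (B * G) (C * J) (D * G)"
    using assms by simp
  have "four_block_mat J (0\<^sub>m p q) (0\<^sub>m q p) G * transpose_mat (four_block_mat A B C D)
      = four_block_mat (J * transpose_mat A + 0\<^sub>m p q * transpose_mat B)
          (J * transpose_mat C + 0\<^sub>m p q * transpose_mat D)
          (0\<^sub>m q p * transpose_mat A + G * transpose_mat B)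
          (0\<^sub>m q p * transpose_mat C + G * transpose_mat D)"
    unfolding transpose_four_block_mat[OF A B C D]
    using assms by (intro mult_four_block_mat) auto
  then have 2: "four_block_mat J (0\<^sub>m p q) (0\<^sub>m q p) G * transpose_mat (four_block_mat A B C D)
      = four_block_mat (J * transpose_mat A) (J * transpose_mat C)
          (G * transpose_mat B) (G * transpose_mat D)"
    using assms by simp
  have 3: "four_block_mat (A * J) (B * G) (C * J) (D * G)
      + four_block_mat (J * transpose_mat A) (J * transpose_mat C)
          (G * transpose_mat B) (G * transpose_mat D)
      = four_block_mat (A * J + J * transpose_mat A) (B * G + J * transpose_mat C)
          (C * J + G * transpose_mat B) (D * G + G * transpose_mat D)"
    using assms by (intro add_four_block_mat) auto
  show ?thesis
    unfolding JG 1 2 3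
    using assms by (intro four_block_mat_eq_zero_iff) auto
qed

lemma mat_add_eq_zero_iff:
  fixes A B :: "'a :: group_add mat"
  assumes "A \<in> carrier_mat m n" and "B \<in> carrier_mat m n"
  shows "A + B = 0\<^sub>m m n \<longleftrightarrow> B = - A"
  using assms by (auto simp: mat_eq_iff add_eq_0_iff)

lemma mult_right_cancel_invertible:
  fixes P P' :: "'a :: semiring_1 mat"
  assumes A: "A \<in> carrier_mat m n" and B: "B \<in> carrier_mat m n"
    and P: "P \<in> carrier_mat n n" and P': "P' \<in> carrier_mat n n" and PP': "P * P' = 1\<^sub>m n"
  shows "A * P = B * P \<longleftrightarrow> A = B"
proof
  assume "A * P = B * P"
  then have "A * P * P' = B * P * P'" by simp
  then show "A = B"
    using A B by (simp add: assoc_mult_mat[OF _ P P'] PP')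
qed simp

lemma lower_left_block_iff:
  fixes B C G J :: "'a :: comm_ring_1 mat"
  assumes B: "B \<in> carrier_mat p q" and C: "C \<in> carrier_mat q p" and J: "J \<in> carrier_mat p p"
    and G: "G \<in> carrier_mat q q" and H: "H \<in> carrier_mat q q"
    and GH: "G * H = 1\<^sub>m q" and HG: "H * G = 1\<^sub>m q"
  shows "C * J + G * transpose_mat B = 0\<^sub>m q p
     \<longleftrightarrow> B = - (transpose_mat J * transpose_mat C * transpose_mat H)"
proof -
  have CJ: "C * J \<in> carrier_mat q p" using C J by simp
  have "G * transpose_mat B = - (C * J) \<longleftrightarrow> transpose_mat B = - (H * (C * J))"
  proof
    assume eq: "G * transpose_mat B = - (C * J)"
    have "transpose_mat B = H * G * transpose_mat B" using B by (simp add: HG)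
    also have "\<dots> = H * (G * transpose_mat B)" using B G H by (intro assoc_mult_mat) auto
    also have "\<dots> = - (H * (C * J))" using H C by (simp add: eq)
    finally show "transpose_mat B = - (H * (C * J))" .
  next
    assume "transpose_mat B = - (H * (C * J))"
    then have "G * transpose_mat B = - (G * (H * (C * J)))" using G H CJ by simp
    also have "G * (H * (C * J)) = G * H * (C * J)"
      using G H CJ by (intro assoc_mult_mat[symmetric]) auto
    finally show "G * transpose_mat B = - (C * J)" by (simp add: GH left_mult_one_mat[OF CJ])
  qed
  also have "\<dots> \<longleftrightarrow> B = transpose_mat (- (H * (C * J)))"
    by (metis transpose_transpose)
  also have "transpose_mat (- (H * (C * J))) = - (transpose_mat J * transpose_mat C * transpose_mat H)"
    by (simp only: transpose_uminus transpose_mult[OF H CJ] transpose_mult[OF C J])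
  finally show ?thesis
    using assms by (subst mat_add_eq_zero_iff) auto
qed

text \<open>With \<open>B\<close> eliminated the block equation reads \<open>J Y = J\<^sup>T Y \<Gamma>\<^sup>-\<^sup>T \<Gamma>\<close> for \<open>Y = C\<^sup>T\<close>; multiplying by the
  invertible \<open>P\<close> on the right turns the cosquare into \<open>L\<close>.\<close>

lemma upper_right_block_iff:
  assumes C: "C \<in> carrier_mat q p" and J: "J \<in> carrier_mat p p"
    and B: "B = - (transpose_mat J * transpose_mat C * mat_inv_transpose (Gamma_mat q))"
  shows "B * Gamma_mat q + J * transpose_mat C = 0\<^sub>m p q
     \<longleftrightarrow> transpose_mat J * (transpose_mat C * P_mat q * ((- 1) ^ (q - 1) \<cdot>\<^sub>m (1\<^sub>m q + jordan_block q 0)))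
           = J * (transpose_mat C * P_mat q)" (is "_ \<longleftrightarrow> _ * (_ * ?L) = _")
proof -
  let ?G = "Gamma_mat q" and ?P = "P_mat q" and ?Jt = "transpose_mat J" and ?Y = "transpose_mat C"
  define H where "H = transpose_mat (mat_inv ?G)"
  note G = Gamma_mat_carrier[of q] and P = P_mat_carrier[of q]
  note invG = mat_inv_of_det[OF G det_Gamma_mat] and invP = mat_inv_of_det[OF P det_P_mat]
  have H: "H \<in> carrier_mat q q" using invG(1) by (simp add: H_def)
  have HGt: "H * transpose_mat ?G = 1\<^sub>m q"
    using transpose_mult[OF G invG(1)] by (simp add: H_def invG(2))
  have Jt: "?Jt \<in> carrier_mat p p" and Y: "?Y \<in> carrier_mat p q" using J C by auto
  have L: "?L \<in> carrier_mat q q" by simp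
  have HGP: "H * (?G * ?P) = ?P * ?L"
  proof -
    have "H * (?G * ?P) = H * transpose_mat ?G * (?P * ?L)"
      unfolding Gamma_mat_mult_P_mat
      using H by (intro assoc_mult_mat[of _ q q _ q _ q, symmetric]) (auto intro!: mult_carrier_mat)
    then show ?thesis by (simp only: HGt left_mult_one_mat[OF mult_carrier_mat[OF P L]])
  qed
  have GP: "?G * ?P \<in> carrier_mat q q" and PL: "?P * ?L \<in> carrier_mat q q"
    by (rule mult_carrier_mat[OF G P], rule mult_carrier_mat[OF P L])
  have JtY: "?Jt * ?Y \<in> carrier_mat p q" by (rule mult_carrier_mat[OF Jt Y])
  have JtYH: "?Jt * ?Y * H \<in> carrier_mat p q" by (rule mult_carrier_mat[OF JtY H])
  have JY: "J * ?Y \<in> carrier_mat p q" by (rule mult_carrier_mat[OF J Y])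
  have "B * ?G = - (?Jt * ?Y * H * ?G)"
    unfolding B H_def by (rule uminus_mult_left_mat) (use invG(1) carrier_matD(1)[OF G] in auto)
  then have "B * ?G + J * ?Y = 0\<^sub>m p q \<longleftrightarrow> J * ?Y = ?Jt * ?Y * H * ?G"
    using mat_add_eq_zero_iff[OF _ JY, of "- (?Jt * ?Y * H * ?G)"] mult_carrier_mat[OF JtYH G] by simp
  also have "\<dots> \<longleftrightarrow> J * ?Y * ?P = ?Jt * ?Y * H * ?G * ?P"
    by (rule mult_right_cancel_invertible[OF JY mult_carrier_mat[OF JtYH G] P invP(1,2), symmetric])
  also have "J * ?Y * ?P = J * (?Y * ?P)"
    by (rule assoc_mult_mat[OF J Y P])
  also have "?Jt * ?Y * H * ?G * ?P = ?Jt * (?Y * ?P * ?L)"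
  proof -
    have "?Jt * ?Y * H * ?G * ?P = ?Jt * ?Y * H * (?G * ?P)"
      by (rule assoc_mult_mat[OF JtYH G P])
    also have "\<dots> = ?Jt * ?Y * (H * (?G * ?P))"
      by (rule assoc_mult_mat[OF JtY H GP])
    also have "\<dots> = ?Jt * ?Y * (?P * ?L)" by (simp only: HGP)
    also have "\<dots> = ?Jt * (?Y * (?P * ?L))"
      by (rule assoc_mult_mat[OF Jt Y PL])
    also have "?Y * (?P * ?L) = ?Y * ?P * ?L"
      by (rule assoc_mult_mat[OF Y P L, symmetric])
    finally show ?thesis .
  qed
  finally show ?thesis by (metis (full_types))
qed

lemma transpose_mult_P_mat_eq_iff:
  assumes C: "C \<in> carrier_mat q p" and W: "W \<in> carrier_mat p q" and T: "T \<in> carrier_mat q q"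
  shows "transpose_mat C * P_mat q = W * T
     \<longleftrightarrow> C = mat_inv_transpose (P_mat q) * transpose_mat T * transpose_mat W"
proof -
  let ?P = "P_mat q"
  define Q where "Q = mat_inv ?P"
  note P = P_mat_carrier[of q]
  have Q: "Q \<in> carrier_mat q q" and PQ: "?P * Q = 1\<^sub>m q" and QP: "Q * ?P = 1\<^sub>m q"
    using mat_inv_of_det[OF P det_P_mat] by (auto simp: Q_def)
  have WT: "W * T \<in> carrier_mat p q" using W T by simp
  have "W * T = W * T * Q * ?P"
    using WT by (simp add: assoc_mult_mat[OF WT Q P] QP right_mult_one_mat[OF WT])
  then have "transpose_mat C * ?P = W * T \<longleftrightarrow> transpose_mat C * ?P = W * T * Q * ?P"
    by simp
  also have "\<dots> \<longleftrightarrow> transpose_mat C = W * T * Q"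
    using C WT Q by (intro mult_right_cancel_invertible[OF _ _ P Q PQ]) (auto intro: mult_carrier_mat[OF WT Q])
  also have "\<dots> \<longleftrightarrow> C = transpose_mat (W * T * Q)"
    by (metis transpose_transpose)
  also have "transpose_mat (W * T * Q) = transpose_mat Q * transpose_mat T * transpose_mat W"
    unfolding transpose_mult[OF WT Q] transpose_mult[OF W T]
    using W T Q by (intro assoc_mult_mat[symmetric]) auto
  finally show ?thesis by (simp only: Q_def)
qed

theorem mainTheorem1:
  fixes p q :: nat and X A B C D :: "complex mat"
  assumes "p \<ge> 1" and "q \<ge> 1" and "odd p"
    and "A \<in> carrier_mat p p" and "B \<in> carrier_mat p q"
    and "C \<in> carrier_mat q p" and "D \<in> carrier_mat q q"
    and "X = four_block_mat A B C D"
  shows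
    "X * diag_block_mat [jordan_block p 0, Gamma_mat q]
       + diag_block_mat [jordan_block p 0, Gamma_mat q] * transpose_mat X = 0\<^sub>m (p + q) (p + q)
     \<longleftrightarrow>
       A * jordan_block p 0 + jordan_block p 0 * transpose_mat A = 0\<^sub>m p p
     \<and> D * Gamma_mat q + Gamma_mat q * transpose_mat D = 0\<^sub>m q q
     \<and> (\<exists>\<alpha> :: nat \<Rightarrow> complex.
          C = mat_inv_transpose (P_mat q)
              * (\<Oplus>\<^bsub>ring_mat TYPE(complex) q ()\<^esub> l\<in>{1..q}.
                   \<alpha> l \<cdot>\<^sub>m (transpose_mat (jordan_block q 0) ^\<^sub>m (l - 1)))
              * transpose_mat (W_mat p q))
     \<and> B = - (transpose_mat (jordan_block p 0) * transpose_mat C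
               * mat_inv_transpose (Gamma_mat q))"
proof -
  let ?J = "jordan_block p (0 :: complex)" and ?G = "Gamma_mat q"
  note A = assms(4) and B = assms(5) and C = assms(6) and D = assms(7)
  note invG = mat_inv_of_det[OF Gamma_mat_carrier det_Gamma_mat, of q]
  have lower_left: "C * ?J + ?G * transpose_mat B = 0\<^sub>m q p
      \<longleftrightarrow> B = - (transpose_mat ?J * transpose_mat C * mat_inv_transpose ?G)"
    by (intro lower_left_block_iff[OF B C _ Gamma_mat_carrier invG]) simp
  have C_form: "(\<exists>\<alpha>. C = mat_inv_transpose (P_mat q)
              * (\<Oplus>\<^bsub>ring_mat TYPE(complex) q ()\<^esub> l\<in>{1..q}.
                   \<alpha> l \<cdot>\<^sub>m (transpose_mat (jordan_block q 0) ^\<^sub>m (l - 1)))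
              * transpose_mat (W_mat p q))
      \<longleftrightarrow> (\<exists>\<alpha>. transpose_mat C * P_mat q = W_mat p q * toeplitz q \<alpha>)"
    unfolding finsum_jordan_block_pow_eq_toeplitz
    using transpose_mult_P_mat_eq_iff[OF C W_mat_carrier toeplitz_carrier] by simp
  have upper_right: "B * ?G + ?J * transpose_mat C = 0\<^sub>m p q
      \<longleftrightarrow> (\<exists>\<alpha>. transpose_mat C * P_mat q = W_mat p q * toeplitz q \<alpha>)"
    if "B = - (transpose_mat ?J * transpose_mat C * mat_inv_transpose ?G)"
    using upper_right_block_iff[OF C jordan_block_carrier that]
      jordan_shift_equation_iff[OF \<open>odd p\<close>, of "transpose_mat C * P_mat q" q] C
    by simp
  show ?thesis
    unfolding \<open>X = four_block_mat A B C D\<close>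
      block_congruence_equation_iff[OF A B C D jordan_block_carrier Gamma_mat_carrier] C_form
    using lower_left upper_right by blast
qed

end
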